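(* Let $L=\{0110,1001\}$. Then $\mathcal{G}_L$ is exactly the class of permutation graphs.
   Context: All graphs are finite, simple, undirected, with nonempty vertex sets, and graph classes are considered up to isomorphism. A graph $G=([n],E)$ is a permutation graph if there is a bijection $\pi:[n]\to[n]$ such that for all distinct $i,j$: $\{i,j\}\in E$ iff $(i-j)(\pi(i)-\pi(j))<0$; a graph is a permutation graph if it is isomorphic to such a graph. For an alphabet $V$ and distinct $u,v\in V$, $h_{u,v}:V^*\to\{0,1\}^*$ is the monoid morphism with $u\mapsto 0$, $v\mapsto 1$ and $x\mapsto\lambda$ (empty word) for all other letters $x$. For a language $L\subseteq\{0,1\}^*$ closed under exchanging 0 and 1 and a nonempty word $w$ whose set of occurring letters is $V$, $G(L,w)$ is the graph with vertex set $V$ in which distinct $u,v$ are adjacent iff $h_{u,v}(w)\in L$. $\mathcal{G}_L$ is the class of all graphs isomorphic to some $G(L,w)$. *)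

theory Defs
  imports "Graph_Theory.Pair_Digraph" "Graph_Theory.Digraph_Isomorphism" "HOL-Library.Z2"
begin

text \<open>
  An undirected graph is a loop-free symmetric digraph (locale \<^locale>\<open>pair_graph\<close>, which includes
  finiteness): the edge \<open>{u, v}\<close> is represented by the two arcs \<open>(u, v)\<close> and \<open>(v, u)\<close>.
\<close>

definition simple_graph :: "'a pair_pre_digraph \<Rightarrow> bool" where
  "simple_graph G \<longleftrightarrow> pair_graph G \<and> pverts G \<noteq> {}"

definition graph_iso :: "'a pair_pre_digraph \<Rightarrow> 'b pair_pre_digraph \<Rightarrow> bool" where
  "graph_iso G H \<longleftrightarrow> digraph_iso (with_proj G) (with_proj H)"

definition permutation_graph_on :: "nat \<Rightarrow> nat pair_pre_digraph \<Rightarrow> bool" where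
  "permutation_graph_on n G \<longleftrightarrow>
     simple_graph G \<and> pverts G = {1..n} \<and>
     (\<exists>\<pi>. bij_betw \<pi> {1..n} {1..n} \<and>
        (\<forall>i \<in> {1..n}. \<forall>j \<in> {1..n}. i \<noteq> j \<longrightarrow>
           ((i, j) \<in> parcs G \<longleftrightarrow> (int i - int j) * (int (\<pi> i) - int (\<pi> j)) < 0)))"

definition permutation_graph :: "'a pair_pre_digraph \<Rightarrow> bool" where
  "permutation_graph G \<longleftrightarrow> simple_graph G \<and> (\<exists>n H. permutation_graph_on n H \<and> graph_iso G H)"

definition proj_word :: "'v \<Rightarrow> 'v \<Rightarrow> 'v list \<Rightarrow> bit list" where
  "proj_word u v w = concat (map (\<lambda>x. if x = u then [0] else if x = v then [1] else []) w)"

definition exchange_closed :: "bit list set \<Rightarrow> bool" where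
  "exchange_closed L \<longleftrightarrow> (\<forall>x \<in> L. map (\<lambda>b. 1 - b) x \<in> L)"

text \<open>Meaningful for languages that are \<^const>\<open>exchange_closed\<close>; otherwise the arcs need not be symmetric.\<close>

definition word_graph :: "bit list set \<Rightarrow> 'v list \<Rightarrow> 'v pair_pre_digraph" where
  "word_graph L w =
     \<lparr> pverts = set w,
       parcs = {(u, v). u \<in> set w \<and> v \<in> set w \<and> u \<noteq> v \<and> proj_word u v w \<in> L} \<rparr>"

text \<open>
  Letters are taken to be natural numbers. As the class is closed under isomorphism, this is no
  restriction: see \<open>word_graph_in_graph_class\<close> below for words over an arbitrary alphabet.
\<close>

definition graph_class :: "bit list set \<Rightarrow> 'a pair_pre_digraph set" where
  "graph_class L = {G. simple_graph G \<and> (\<exists>w :: nat list. w \<noteq> [] \<and> graph_iso G (word_graph L w))}"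

lemma graph_iso_iff:
  assumes "pair_wf_digraph G" "pair_wf_digraph H"
  shows "graph_iso G H \<longleftrightarrow>
    (\<exists>f. bij_betw f (pverts G) (pverts H) \<and>
       (\<forall>u \<in> pverts G. \<forall>v \<in> pverts G. (u, v) \<in> parcs G \<longleftrightarrow> (f u, f v) \<in> parcs H))"
    (is "?L \<longleftrightarrow> ?R")
proof
  interpret G: pair_wf_digraph G by fact
  assume ?L
  then obtain h where h: "pre_digraph.digraph_isomorphism (with_proj G) h"
    and H: "with_proj H = app_iso h (with_proj G)"
    unfolding graph_iso_def digraph_iso_def by blast
  have inj: "inj_on (iso_verts h) (pverts G)"
    and comp: "\<forall>a \<in> parcs G. iso_verts h (fst a) = iso_tail h (iso_arcs h a) \<and>
                            iso_verts h (snd a) = iso_head h (iso_arcs h a)"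
    using h unfolding pre_digraph.digraph_isomorphism_def by simp_all
  have eqs: "pverts H = iso_verts h ` pverts G" "parcs H = iso_arcs h ` parcs G"
      "iso_tail h = fst" "iso_head h = snd"
    using arg_cong[OF H, of verts] arg_cong[OF H, of arcs]
      arg_cong[OF H, of tail] arg_cong[OF H, of head] by simp_all
  have arc: "iso_arcs h a = (iso_verts h (fst a), iso_verts h (snd a))" if "a \<in> parcs G" for a
    using comp that eqs by (simp add: prod_eq_iff)
  have "(u, v) \<in> parcs G \<longleftrightarrow> (iso_verts h u, iso_verts h v) \<in> parcs H"
    if "u \<in> pverts G" "v \<in> pverts G" for u v
  proof
    assume "(u, v) \<in> parcs G"
    then show "(iso_verts h u, iso_verts h v) \<in> parcs H"
      using arc[of "(u, v)"] eqs by force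
  next
    assume "(iso_verts h u, iso_verts h v) \<in> parcs H"
    then obtain a where a: "a \<in> parcs G" "(iso_verts h u, iso_verts h v) = iso_arcs h a"
      using eqs by auto
    then have "fst a = u" "snd a = v"
      using arc[OF a(1)] inj that G.arc_fst_in_verts[OF a(1)] G.arc_snd_in_verts[OF a(1)]
      by (auto dest: inj_onD)
    then show "(u, v) \<in> parcs G" using a(1) by (cases a) simp
  qed
  then show ?R using inj eqs(1) by (auto simp: bij_betw_def)
next
  interpret G: pair_wf_digraph G by fact
  interpret H: pair_wf_digraph H by fact
  assume ?R
  then obtain f where bij: "bij_betw f (pverts G) (pverts H)"
    and adj: "\<And>u v. u \<in> pverts G \<Longrightarrow> v \<in> pverts G \<Longrightarrow> (u, v) \<in> parcs G \<longleftrightarrow> (f u, f v) \<in> parcs H"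
    by blast
  define h where "h = \<lparr> iso_verts = f, iso_arcs = (\<lambda>a. (f (fst a), f (snd a))),
                        iso_head = snd, iso_tail = fst \<rparr>"
  have "inj_on f (pverts G)" using bij by (simp add: bij_betw_def)
  have "inj_on (\<lambda>a. (f (fst a), f (snd a))) (parcs G)"
  proof (rule inj_onI)
    fix a b
    assume ab: "a \<in> parcs G" "b \<in> parcs G" "(f (fst a), f (snd a)) = (f (fst b), f (snd b))"
    have "fst a = fst b" "snd a = snd b"
      using ab(3) \<open>inj_on f (pverts G)\<close> G.arc_fst_in_verts[OF ab(1)] G.arc_fst_in_verts[OF ab(2)]
        G.arc_snd_in_verts[OF ab(1)] G.arc_snd_in_verts[OF ab(2)]
      by (simp_all add: inj_on_eq_iff)
    then show "a = b" by (simp add: prod_eq_iff)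
  qed
  then have iso: "pre_digraph.digraph_isomorphism (with_proj G) h"
    using \<open>inj_on f (pverts G)\<close> G.wf_digraph
    unfolding pre_digraph.digraph_isomorphism_def h_def by (simp add: wf_digraph_wp_iff assms)
  have "parcs H \<subseteq> (\<lambda>a. (f (fst a), f (snd a))) ` parcs G"
  proof
    fix b assume b: "b \<in> parcs H"
    then have "fst b \<in> f ` pverts G" "snd b \<in> f ` pverts G"
      using bij H.arc_fst_in_verts[OF b] H.arc_snd_in_verts[OF b] by (simp_all add: bij_betw_def)
    then obtain u v where "u \<in> pverts G" "v \<in> pverts G" "b = (f u, f v)"
      by (cases b) auto
    then show "b \<in> (\<lambda>a. (f (fst a), f (snd a))) ` parcs G"
      using adj b by force
  qed
  moreover have "(\<lambda>a. (f (fst a), f (snd a))) ` parcs G \<subseteq> parcs H"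
  proof clarsimp
    fix u v assume "(u, v) \<in> parcs G"
    then show "(f u, f v) \<in> parcs H"
      using adj[OF G.in_arcsD1 G.in_arcsD2] by blast
  qed
  ultimately have "with_proj H = app_iso h (with_proj G)"
    using bij by (simp add: with_proj_def app_iso_def h_def bij_betw_def)
  then show ?L using iso unfolding graph_iso_def digraph_iso_def by blast
qed

lemma proj_word_swap:
  "u \<noteq> v \<Longrightarrow> proj_word v u w = map (\<lambda>b. 1 - b) (proj_word u v w)"
  by (induction w) (auto simp: proj_word_def)

lemma proj_word_map:
  assumes "inj_on f (set w \<union> {u, v})"
  shows "proj_word (f u) (f v) (map f w) = proj_word u v w"
  using assms by (induction w) (auto simp: proj_word_def inj_on_def)

lemma simple_graph_word_graph:
  assumes "exchange_closed L" "w \<noteq> []"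
  shows "simple_graph (word_graph L w)"
proof -
  have "finite (parcs (word_graph L w))"
    by (rule finite_subset[of _ "set w \<times> set w"]) (auto simp: word_graph_def)
  moreover have "sym (parcs (word_graph L w))"
    using assms(1) by (auto simp: word_graph_def sym_def exchange_closed_def proj_word_swap)
  ultimately have "pair_graph (word_graph L w)"
    by unfold_locales (auto simp: word_graph_def symmetric_def)
  then show ?thesis using assms(2) by (simp add: simple_graph_def word_graph_def)
qed

lemma word_graph_in_graph_class:
  fixes w :: "'v list"
  assumes "exchange_closed L" "w \<noteq> []"
  shows "word_graph L w \<in> graph_class L"
proof -
  obtain f :: "'v \<Rightarrow> nat" where f: "inj_on f (set w)"
    using finite_imp_inj_to_nat_seg[of "set w"] by auto
  have "proj_word (f u) (f v) (map f w) = proj_word u v w" if "u \<in> set w" "v \<in> set w" for u v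
    using that f by (intro proj_word_map) (simp add: insert_absorb)
  then have adj: "(u, v) \<in> parcs (word_graph L w) \<longleftrightarrow>
      (f u, f v) \<in> parcs (word_graph L (map f w))" if "u \<in> set w" "v \<in> set w" for u v
    using that f by (auto simp: word_graph_def dest: inj_onD)
  have "graph_iso (word_graph L w) (word_graph L (map f w))"
  proof (subst graph_iso_iff)
    show "pair_wf_digraph (word_graph L w)" "pair_wf_digraph (word_graph L (map f w))"
      by (unfold_locales; auto simp: word_graph_def)+
    show "\<exists>g. bij_betw g (pverts (word_graph L w)) (pverts (word_graph L (map f w))) \<and>
       (\<forall>u \<in> pverts (word_graph L w). \<forall>v \<in> pverts (word_graph L w).
         (u, v) \<in> parcs (word_graph L w) \<longleftrightarrow> (g u, g v) \<in> parcs (word_graph L (map f w)))"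
      using f adj by (intro exI[of _ f]) (simp add: word_graph_def bij_betw_def)
  qed
  then show ?thesis
    using simple_graph_word_graph[OF assms] assms(2)
    by (auto simp: graph_class_def intro!: exI[of _ "map f w"])
qed

lemma exchange_closed_0110_1001: "exchange_closed {[0, 1, 1, 0], [1, 0, 0, 1]}"
  by (simp add: exchange_closed_def)

end

theory Submission
  imports Defs
begin

text \<open>
  Both classes consist of the graphs whose vertices carry two injective numberings \<open>a\<close> and \<open>b\<close>
  such that distinct vertices are adjacent iff the numberings order them oppositely. For a word,
  two letters are adjacent iff both occur exactly twice and their occurrences are nested, so take
  \<open>a\<close> and \<open>b\<close> to be the positions of the first and last occurrence; the remaining letters
  are isolated and are placed behind all others, in the same order for \<open>a\<close> and \<open>b\<close>.
  Conversely, a permutation \<open>\<pi>\<close> of \<open>1, \<dots>, n\<close> is encoded by the word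
  \<open>1 \<dots> n \<pi>\<^sup>-\<^sup>1(1) \<dots> \<pi>\<^sup>-\<^sup>1(n)\<close>.
\<close>

section \<open>Positions of first and last occurrences\<close>

definition first_pos :: "'v list \<Rightarrow> 'v \<Rightarrow> nat" where
  "first_pos w x = length (takeWhile (\<lambda>y. y \<noteq> x) w)"

text \<open>One more than the index of the last occurrence, for letters that occur at all.\<close>

definition last_pos :: "'v list \<Rightarrow> 'v \<Rightarrow> nat" where
  "last_pos w x = length w - first_pos (rev w) x"

lemma first_pos_less: "x \<in> set w \<Longrightarrow> first_pos w x < length w"
  by (induction w) (auto simp: first_pos_def)

lemma nth_first_pos: "x \<in> set w \<Longrightarrow> w ! first_pos w x = x"
  using nth_length_takeWhile[of "\<lambda>y. y \<noteq> x" w] first_pos_less[of x w]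
  by (simp add: first_pos_def)

lemma inj_on_first_pos: "inj_on (first_pos w) (set w)"
  by (rule inj_on_inverseI[of _ "nth w"]) (rule nth_first_pos)

lemma inj_on_last_pos: "inj_on (last_pos w) (set w)"
proof (rule inj_onI)
  fix x y assume xy: "x \<in> set w" "y \<in> set w" "last_pos w x = last_pos w y"
  \<comment> \<open>Truncated subtraction in \<open>last_pos\<close> can be cancelled because both
    values of \<open>first_pos (rev w)\<close> lie below \<open>length w\<close>.\<close>
  then have "first_pos (rev w) x = first_pos (rev w) y"
    using first_pos_less[of x "rev w"] first_pos_less[of y "rev w"] by (simp add: last_pos_def)
  then show "x = y"
    using inj_on_first_pos[of "rev w"] xy by (auto dest: inj_onD)
qed

section \<open>Projections and nested occurrences\<close>

lemma proj_word_append: "proj_word u v (xs @ ys) = proj_word u v xs @ proj_word u v ys"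
  by (simp add: proj_word_def)

lemma proj_word_Cons:
  "proj_word u v (x # xs) = (if x = u then [0] else if x = v then [1] else []) @ proj_word u v xs"
  by (simp add: proj_word_def)

lemma proj_word_eq_Nil_iff: "proj_word u v w = [] \<longleftrightarrow> u \<notin> set w \<and> v \<notin> set w"
  by (induction w) (auto simp: proj_word_def)

lemma count_proj_word_0: "count_list (proj_word u v w) 0 = count_list w u"
  by (induction w) (auto simp: proj_word_def)

lemma count_proj_word_1: "u \<noteq> v \<Longrightarrow> count_list (proj_word u v w) 1 = count_list w v"
  by (induction w) (auto simp: proj_word_def)

text \<open>Splitting at the first occurrence of \<open>u\<close> or \<open>v\<close> accounts for
  one bit. Repeated use recovers the shape of \<open>w\<close> from a known projection.\<close>

lemma proj_word_eq_ConsE: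
  assumes "proj_word u v w = c # r"
  obtains xs x ys where "w = xs @ x # ys" "u \<notin> set xs" "v \<notin> set xs"
    "x = (if c = 0 then u else v)" "proj_word u v ys = r"
proof -
  have "\<exists>xs x ys. w = xs @ x # ys \<and> u \<notin> set xs \<and> v \<notin> set xs \<and>
      x = (if c = 0 then u else v) \<and> proj_word u v ys = r"
    using assms
  proof (induction w)
    case Nil
    then show ?case by (simp add: proj_word_def)
  next
    case (Cons y w)
    show ?case
    proof (cases "y = u \<or> y = v")
      case True
      then have "y = (if c = 0 then u else v)" "proj_word u v w = r"
        using Cons.prems by (auto simp: proj_word_Cons split: if_splits)
      then show ?thesis
        by (intro exI[of _ "[]"] exI[of _ y] exI[of _ w]) simp
    next
      case False
      then have "proj_word u v w = c # r" using Cons.prems by (simp add: proj_word_Cons)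
      then obtain xs x ys where "w = xs @ x # ys" "u \<notin> set xs" "v \<notin> set xs"
        "x = (if c = 0 then u else v)" "proj_word u v ys = r"
        using Cons.IH by blast
      then show ?thesis
        using False by (intro exI[of _ "y # xs"] exI[of _ x] exI[of _ ys]) auto
    qed
  qed
  then show ?thesis using that by blast
qed

lemma length_eq_count_bits: "length (p :: bit list) = count_list p 0 + count_list p 1"
proof (induction p)
  case (Cons c p)
  then show ?case by (cases c) auto
qed simp

text \<open>No membership in \<open>ys\<close> is required: for an absent letter
  \<open>first_pos\<close> returns the length of the word.\<close>

lemma first_pos_append:
  "first_pos (xs @ ys) x = (if x \<in> set xs then first_pos xs x else length xs + first_pos ys x)"
  by (auto simp: first_pos_def takeWhile_append)

lemma first_pos_Cons: "first_pos (y # ys) x = (if y = x then 0 else Suc (first_pos ys x))"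
  by (simp add: first_pos_def)

lemma first_pos_Nil: "first_pos [] x = 0"
  by (simp add: first_pos_def)

text \<open>Only six bit words have two 0s and two 1s. In 0110 and 1001 the first and the last
  occurrences are ordered oppositely; in 0011, 0101, 1010 and 1100 they are ordered alike.\<close>

lemma proj_word_nested_iff:
  assumes "u \<noteq> v" "count_list w u = 2" "count_list w v = 2"
  shows "proj_word u v w \<in> {[0, 1, 1, 0], [1, 0, 0, 1]} \<longleftrightarrow>
    (first_pos w u < first_pos w v \<longleftrightarrow> last_pos w v < last_pos w u)"
proof -
  have counts: "count_list (proj_word u v w) 0 = 2" "count_list (proj_word u v w) 1 = 2"
    using assms by (simp_all add: count_proj_word_0 count_proj_word_1)
  then have "length (proj_word u v w) = 4" by (simp add: length_eq_count_bits)
  then obtain c1 c2 c3 c4 where p: "proj_word u v w = [c1, c2, c3, c4]"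
    by (auto simp: length_Suc_conv numeral_eq_Suc)
  \<comment> \<open>Four peelings expose the four relevant letters of \<open>w\<close>, separated by
    gaps \<open>w1\<close>, ..., \<open>r4\<close> that avoid \<open>u\<close> and
    \<open>v\<close>.\<close>
  obtain w1 x1 r1 where w1: "w = w1 @ x1 # r1" "u \<notin> set w1" "v \<notin> set w1"
    "x1 = (if c1 = 0 then u else v)" and r1: "proj_word u v r1 = [c2, c3, c4]"
    using proj_word_eq_ConsE[OF p] by metis
  obtain w2 x2 r2 where w2: "r1 = w2 @ x2 # r2" "u \<notin> set w2" "v \<notin> set w2"
    "x2 = (if c2 = 0 then u else v)" and r2: "proj_word u v r2 = [c3, c4]"
    using proj_word_eq_ConsE[OF r1] by metis
  obtain w3 x3 r3 where w3: "r2 = w3 @ x3 # r3" "u \<notin> set w3" "v \<notin> set w3"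
    "x3 = (if c3 = 0 then u else v)" and r3: "proj_word u v r3 = [c4]"
    using proj_word_eq_ConsE[OF r2] by metis
  obtain w4 x4 r4 where w4: "r3 = w4 @ x4 # r4" "u \<notin> set w4" "v \<notin> set w4"
    "x4 = (if c4 = 0 then u else v)" and r4: "proj_word u v r4 = []"
    using proj_word_eq_ConsE[OF r3] by metis
  have r4': "u \<notin> set r4" "v \<notin> set r4" using r4 by (simp_all add: proj_word_eq_Nil_iff)
  have w: "w = w1 @ x1 # w2 @ x2 # w3 @ x3 # w4 @ x4 # r4"
    using w1(1) w2(1) w3(1) w4(1) by simp
  note simps = first_pos_append first_pos_Cons first_pos_Nil last_pos_def
  show ?thesis
    using counts assms(1) w1(2-4) w2(2-4) w3(2-4) w4(2-4) r4' unfolding p unfolding w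
    \<comment> \<open>\<open>counts\<close> refutes all but six of the sixteen bit patterns; in
      those the positions are computed from the lengths of the gaps.\<close>
    by (cases c1; cases c2; cases c3; cases c4) (simp_all add: simps)
qed

text \<open>This is why a letter that does not occur exactly twice is an isolated vertex.\<close>

lemma proj_word_nested_imp_count:
  assumes "u \<noteq> v" "proj_word u v w \<in> {[0, 1, 1, 0], [1, 0, 0, 1]}"
  shows "count_list w u = 2" "count_list w v = 2"
  using assms(2) count_proj_word_0[of u v w] count_proj_word_1[OF assms(1), of w] by auto

lemma word_graph_numberings:
  fixes w :: "'v list"
  obtains a b :: "'v \<Rightarrow> nat" where "inj_on a (set w)" "inj_on b (set w)"
    "\<And>u v. u \<in> set w \<Longrightarrow> v \<in> set w \<Longrightarrow> u \<noteq> v \<Longrightarrow>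
      proj_word u v w \<in> {[0, 1, 1, 0], [1, 0, 0, 1]} \<longleftrightarrow> (a u < a v \<longleftrightarrow> b v < b u)"
proof
  let ?D = "{x. count_list w x = 2}"
  \<comment> \<open>The \<open>Suc\<close> is needed because \<open>last_pos\<close> can equal
    \<open>length w\<close>. Using \<open>first_pos\<close> for both numberings keeps the isolated
    letters in the same order.\<close>
  let ?rest = "\<lambda>x. Suc (length w + first_pos w x)"
  define a where "a x = (if x \<in> ?D then first_pos w x else ?rest x)" for x
  define b where "b x = (if x \<in> ?D then last_pos w x else ?rest x)" for x
  have bounds: "first_pos w x < ?rest y" "last_pos w x < ?rest y" for x y
    by (simp_all add: first_pos_def last_pos_def length_takeWhile_le le_imp_less_Suc trans_le_add1)
  show "inj_on a (set w)"
    using less_imp_neq[OF bounds(1)] less_imp_neq[OF bounds(1), symmetric]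
    by (auto simp: inj_on_def a_def dest: inj_onD[OF inj_on_first_pos])
  show "inj_on b (set w)"
    using less_imp_neq[OF bounds(2)] less_imp_neq[OF bounds(2), symmetric]
    by (auto simp: inj_on_def b_def dest: inj_onD[OF inj_on_first_pos] inj_onD[OF inj_on_last_pos])
  fix u v assume uv: "u \<in> set w" "v \<in> set w" "u \<noteq> v"
  show "proj_word u v w \<in> {[0, 1, 1, 0], [1, 0, 0, 1]} \<longleftrightarrow> (a u < a v \<longleftrightarrow> b v < b u)"
  proof (cases "u \<in> ?D \<and> v \<in> ?D")
    case True
    then show ?thesis using proj_word_nested_iff[OF uv(3), of w] by (simp add: a_def b_def)
  next
    case False
    then have "proj_word u v w \<notin> {[0, 1, 1, 0], [1, 0, 0, 1]}"
      using proj_word_nested_imp_count[OF uv(3), of w] by blast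
    \<comment> \<open>At least one of the two letters is isolated, so \<open>a\<close> and
      \<open>b\<close> order them alike. Distinct first positions exclude a tie when both are
      isolated.\<close>
    moreover have "first_pos w u \<noteq> first_pos w v"
      using inj_on_first_pos[of w] uv by (auto dest: inj_onD)
    then have "a u < a v \<longleftrightarrow> \<not> b v < b u"
      using False bounds[of u v] bounds[of v u] by (auto simp: a_def b_def)
    ultimately show ?thesis by blast
  qed
qed

section \<open>From two numberings to a permutation\<close>

definition rank :: "('a \<Rightarrow> nat) \<Rightarrow> 'a set \<Rightarrow> 'a \<Rightarrow> nat" where
  "rank a V u = card {v \<in> V. a v \<le> a u}"

lemma rank_less_iff:
  assumes "finite V" "u \<in> V" "v \<in> V"
  shows "rank a V u < rank a V v \<longleftrightarrow> a u < a v"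
proof
  assume "a u < a v"
  then have "{x \<in> V. a x \<le> a u} \<subset> {x \<in> V. a x \<le> a v}" using assms(3) by force
  then show "rank a V u < rank a V v"
    unfolding rank_def using assms(1) by (intro psubset_card_mono) auto
next
  assume less: "rank a V u < rank a V v"
  show "a u < a v"
  proof (rule ccontr)
    assume "\<not> a u < a v"
    then have "rank a V v \<le> rank a V u"
      unfolding rank_def using assms(1) by (intro card_mono) auto
    then show False using less by simp
  qed
qed

text \<open>Ranks start at 1 because each element counts itself. Preserving strict order makes
  \<open>rank\<close> injective, and equal cardinalities make it onto.\<close>

lemma bij_betw_rank:
  assumes "finite V" "inj_on a V"
  shows "bij_betw (rank a V) V {1..card V}"
proof -
  have inj: "inj_on (rank a V) V"
    using assms rank_less_iff[OF assms(1), of _ _ a]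
    by (intro inj_onI) (metis inj_onD less_irrefl nat_neq_iff)
  have "rank a V u \<in> {1..card V}" if "u \<in> V" for u
  proof -
    have "0 < rank a V u"
      unfolding rank_def using assms(1) that by (auto simp: card_gt_0_iff)
    moreover have "rank a V u \<le> card V"
      unfolding rank_def using assms(1) by (intro card_mono) auto
    ultimately show ?thesis by simp
  qed
  then have "rank a V ` V \<subseteq> {1..card V}" by blast
  then have "rank a V ` V = {1..card V}"
    using card_image[OF inj] by (intro card_subset_eq) auto
  then show ?thesis using inj by (simp add: bij_betw_def)
qed

lemma int_mult_diff_neg_iff:
  "(int i - int j) * (int k - int l) < 0 \<longleftrightarrow> (i < j \<and> l < k) \<or> (j < i \<and> k < l)"
  by (auto simp: mult_less_0_iff)

text \<open>Only the relative order of the values of \<open>a\<close> and \<open>b\<close> matters,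
  so both may be replaced by ranks. Vertices are then renamed by their
  \<open>a\<close>-rank.\<close>

lemma permutation_graph_if_numberings:
  fixes a b :: "'a \<Rightarrow> nat"
  assumes G: "simple_graph G"
    and a: "inj_on a (pverts G)" and b: "inj_on b (pverts G)"
    and adj: "\<And>u v. u \<in> pverts G \<Longrightarrow> v \<in> pverts G \<Longrightarrow> u \<noteq> v \<Longrightarrow>
      (u, v) \<in> parcs G \<longleftrightarrow> (a u < a v \<longleftrightarrow> b v < b u)"
  shows "permutation_graph G"
proof -
  interpret G: pair_graph G using G by (simp add: simple_graph_def)
  let ?V = "pverts G"
  let ?n = "card ?V"
  have fin: "finite ?V" by simp
  have "?V \<noteq> {}" using G by (simp add: simple_graph_def)
  then have n: "1 \<le> ?n" using fin by (simp add: Suc_le_eq card_gt_0_iff)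
  define f where "f = rank a ?V"
  define g where "g = rank b ?V"
  have f: "bij_betw f ?V {1..?n}" unfolding f_def by (rule bij_betw_rank[OF fin a])
  have g: "bij_betw g ?V {1..?n}" unfolding g_def by (rule bij_betw_rank[OF fin b])
  \<comment> \<open>The permutation sends the \<open>a\<close>-rank of a vertex to its
    \<open>b\<close>-rank.\<close>
  define \<pi> where "\<pi> = g \<circ> inv_into ?V f"
  have \<pi>: "bij_betw \<pi> {1..?n} {1..?n}"
    unfolding \<pi>_def by (rule bij_betw_trans[OF bij_betw_inv_into[OF f] g])
  have \<pi>_f: "\<pi> (f u) = g u" if "u \<in> ?V" for u
    using that f by (simp add: \<pi>_def bij_betw_def)
  define H where "H = \<lparr>pverts = {1..?n},
    parcs = {(i, j). i \<in> {1..?n} \<and> j \<in> {1..?n} \<and> i \<noteq> j \<and>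
      (int i - int j) * (int (\<pi> i) - int (\<pi> j)) < 0}\<rparr>"
  have "finite (parcs H)"
    by (rule finite_subset[of _ "{1..?n} \<times> {1..?n}"]) (auto simp: H_def)
  moreover have "sym (parcs H)"
    by (rule symI) (auto simp: H_def int_mult_diff_neg_iff)
  ultimately have pg: "pair_graph H"
    by unfold_locales (auto simp: H_def symmetric_def)
  then have "simple_graph H" using n by (simp add: simple_graph_def H_def)
  then have "permutation_graph_on ?n H"
    using \<pi> by (auto simp: permutation_graph_on_def H_def)
  moreover have "graph_iso G H"
  proof (subst graph_iso_iff)
    show "pair_wf_digraph G" by unfold_locales
    interpret H: pair_graph H by (rule pg)
    show "pair_wf_digraph H" by unfold_locales
    have "(u, v) \<in> parcs G \<longleftrightarrow> (f u, f v) \<in> parcs H" if uv: "u \<in> ?V" "v \<in> ?V" for u v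
    proof (cases "u = v")
      case True
      then show ?thesis using G.no_loops[of "(u, u)"] by (auto simp: H_def)
    next
      case False
      have ne: "a u \<noteq> a v" "b u \<noteq> b v" using False uv a b by (auto dest: inj_onD)
      have "f u \<in> {1..?n}" "f v \<in> {1..?n}" using uv f by (auto simp: bij_betw_def)
      moreover have "f u \<noteq> f v" using False uv f by (auto simp: bij_betw_def dest: inj_onD)
      ultimately have "(f u, f v) \<in> parcs H \<longleftrightarrow>
          (int (f u) - int (f v)) * (int (g u) - int (g v)) < 0"
        by (simp add: H_def \<pi>_f uv)
      also have "\<dots> \<longleftrightarrow> (a u < a v \<and> b v < b u) \<or> (a v < a u \<and> b u < b v)"
        unfolding int_mult_diff_neg_iff f_def g_def using uv by (simp add: rank_less_iff)
      \<comment> \<open>By \<open>ne\<close>, failure of both comparisons in \<open>adj\<close>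
        means that both reversed strict inequalities hold.\<close>
      also have "\<dots> \<longleftrightarrow> (u, v) \<in> parcs G"
        using adj[OF uv False] ne by auto
      finally show ?thesis by blast
    qed
    then show "\<exists>f. bij_betw f (pverts G) (pverts H) \<and>
       (\<forall>u\<in>pverts G. \<forall>v\<in>pverts G. ((u, v) \<in> parcs G) = ((f u, f v) \<in> parcs H))"
      using f by (intro exI[of _ f]) (simp add: H_def)
  qed
  ultimately show ?thesis using G by (auto simp: permutation_graph_def)
qed

section \<open>From a permutation to a word\<close>

lemma proj_word_distinct:
  assumes "distinct w" "u \<in> set w" "v \<in> set w" "u \<noteq> v"
  shows "proj_word u v w = (if first_pos w u < first_pos w v then [0, 1] else [1, 0])"
proof -
  have Nil: "u \<notin> set xs \<Longrightarrow> v \<notin> set xs \<Longrightarrow> proj_word u v xs = []" for xs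
    by (simp add: proj_word_eq_Nil_iff)
  obtain xs ys where w: "w = xs @ u # ys" using assms(2) by (auto simp: in_set_conv_decomp)
  consider "v \<in> set xs" | "v \<in> set ys" using assms w by auto
  then show ?thesis
  proof cases
    case 1
    then obtain xs1 xs2 where "xs = xs1 @ v # xs2" by (auto simp: in_set_conv_decomp)
    then show ?thesis using assms w
      by (simp add: proj_word_append proj_word_Cons Nil first_pos_append first_pos_Cons)
  next
    case 2
    then obtain ys1 ys2 where "ys = ys1 @ v # ys2" by (auto simp: in_set_conv_decomp)
    then show ?thesis using assms w
      by (simp add: proj_word_append proj_word_Cons Nil first_pos_append first_pos_Cons)
  qed
qed

lemma first_pos_nth:
  assumes "distinct w" "k < length w"
  shows "first_pos w (w ! k) = k"
  using assms first_pos_less[of "w ! k" w] nth_first_pos[of "w ! k" w]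
  by (simp add: nth_eq_iff_index_eq)

text \<open>The vertices \<open>1, ..., n\<close> serve as letters themselves, so equality is
  obtained rather than mere isomorphism.\<close>

lemma permutation_graph_on_eq_word_graph:
  assumes H: "permutation_graph_on n H"
  obtains w where "w \<noteq> []" "H = word_graph {[0, 1, 1, 0], [1, 0, 0, 1]} w"
proof -
  obtain \<pi> where \<pi>: "bij_betw \<pi> {1..n} {1..n}"
    and adj: "\<And>i j. i \<in> {1..n} \<Longrightarrow> j \<in> {1..n} \<Longrightarrow> i \<noteq> j \<Longrightarrow>
      (i, j) \<in> parcs H \<longleftrightarrow> (int i - int j) * (int (\<pi> i) - int (\<pi> j)) < 0"
    using H unfolding permutation_graph_on_def by blast
  have sg: "simple_graph H" and V: "pverts H = {1..n}"
    using H by (simp_all add: permutation_graph_on_def)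
  interpret H: pair_graph H using sg by (simp add: simple_graph_def)
  have n: "1 \<le> n" using sg V by (simp add: simple_graph_def)
  \<comment> \<open>Listing the values of the inverse puts the letter \<open>i\<close> at place
    \<open>\<pi> i\<close> of the second half.\<close>
  define \<sigma> where "\<sigma> = inv_into {1..n} \<pi>"
  have \<sigma>: "bij_betw \<sigma> {1..n} {1..n}"
    unfolding \<sigma>_def by (rule bij_betw_inv_into[OF \<pi>])
  have \<sigma>_\<pi>: "\<sigma> (\<pi> i) = i" if "i \<in> {1..n}" for i
    using that \<pi> by (simp add: \<sigma>_def bij_betw_def)
  define w1 where "w1 = [1..<Suc n]"
  define w2 where "w2 = map \<sigma> [1..<Suc n]"
  have iv: "set [1..<Suc n] = {1..n}" by auto
  have set1: "set w1 = {1..n}" unfolding w1_def by (rule iv)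
  have set2: "set w2 = {1..n}"
    using \<sigma> unfolding w2_def set_map iv by (simp add: bij_betw_def)
  have dist1: "distinct w1" unfolding w1_def by (rule distinct_upt)
  have dist2: "distinct w2"
    using \<sigma> unfolding w2_def distinct_map iv by (simp add: bij_betw_def)
  \<comment> \<open>Letters count from 1 but list positions from 0, hence the \<open>- 1\<close>
    here and in \<open>pos2\<close>.\<close>
  have pos1: "first_pos w1 i = i - 1" if "i \<in> {1..n}" for i
  proof -
    have "w1 ! (i - 1) = i" "i - 1 < length w1"
      using that by (auto simp: w1_def simp del: upt_Suc)
    then show ?thesis using first_pos_nth[OF dist1] by metis
  qed
  have pos2: "first_pos w2 i = \<pi> i - 1" if "i \<in> {1..n}" for i
  proof -
    have "\<pi> i \<in> {1..n}" using that \<pi> by (auto simp: bij_betw_def)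
    then have "w2 ! (\<pi> i - 1) = i" "\<pi> i - 1 < length w2"
      using \<sigma>_\<pi>[OF that] by (auto simp: w2_def simp del: upt_Suc)
    then show ?thesis using first_pos_nth[OF dist2] by metis
  qed
  define L :: "bit list set" where "L = {[0, 1, 1, 0], [1, 0, 0, 1]}"
  have mem: "(i, j) \<in> parcs H \<longleftrightarrow> proj_word i j (w1 @ w2) \<in> L"
    if ij: "i \<in> {1..n}" "j \<in> {1..n}" "i \<noteq> j" for i j
  proof -
    \<comment> \<open>All values are at least 1, so subtracting 1 preserves comparisons. Each half
      contributes 01 or 10, and the projection lies in \<open>L\<close> iff the halves differ, that
      is, iff \<open>i\<close> and \<open>j\<close> form an inversion.\<close>
    have "\<pi> i \<in> {1..n}" "\<pi> j \<in> {1..n}" using ij \<pi> by (auto simp: bij_betw_def)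
    moreover have "\<pi> i \<noteq> \<pi> j" using ij \<sigma>_\<pi> by metis
    moreover have "proj_word i j (w1 @ w2) =
        (if i - 1 < j - 1 then [0, 1] else [1, 0]) @ (if \<pi> i - 1 < \<pi> j - 1 then [0, 1] else [1, 0])"
      using ij set1 set2 dist1 dist2
      by (simp add: proj_word_append proj_word_distinct pos1 pos2)
    ultimately show ?thesis
      using ij adj[OF ij] by (auto simp: L_def int_mult_diff_neg_iff)
  qed
  have "parcs H = parcs (word_graph L (w1 @ w2))"
  proof (rule set_eqI)
    fix e :: "nat \<times> nat"
    obtain i j where e: "e = (i, j)" by (cases e)
    have "i \<in> {1..n} \<and> j \<in> {1..n} \<and> i \<noteq> j" if "(i, j) \<in> parcs H"
      using H.in_arcsD1[OF that] H.in_arcsD2[OF that] H.no_loops[OF that] unfolding V by simp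
    then have "(i, j) \<in> parcs H \<longleftrightarrow> i \<in> {1..n} \<and> j \<in> {1..n} \<and> i \<noteq> j \<and> proj_word i j (w1 @ w2) \<in> L"
      using mem by blast
    also have "\<dots> \<longleftrightarrow> (i, j) \<in> parcs (word_graph L (w1 @ w2))"
      unfolding word_graph_def set_append set1 set2 by simp
    finally show "e \<in> parcs H \<longleftrightarrow> e \<in> parcs (word_graph L (w1 @ w2))"
      unfolding e .
  qed
  then have "H = word_graph L (w1 @ w2)"
    using V by (intro pair_pre_digraph.equality) (simp_all add: word_graph_def set1 set2)
  moreover have "w1 @ w2 \<noteq> []" using n by (simp add: w1_def)
  ultimately show ?thesis using that unfolding L_def by blast
qed

theorem mainTheorem20:
  fixes L :: "bit list set"
  assumes "L = {[0, 1, 1, 0], [1, 0, 0, 1]}"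
  shows "(graph_class L :: 'a pair_pre_digraph set) = {G. permutation_graph G}"
proof (intro set_eqI iffI)
  fix G :: "'a pair_pre_digraph"
  assume "G \<in> graph_class L"
  then obtain w :: "nat list" where G: "simple_graph G" and w: "w \<noteq> []"
    and iso: "graph_iso G (word_graph L w)"
    by (auto simp: graph_class_def)
  interpret G: pair_graph G using G by (simp add: simple_graph_def)
  have wf: "pair_wf_digraph G" by unfold_locales
  have wf': "pair_wf_digraph (word_graph L w)"
    by unfold_locales (auto simp: word_graph_def)
  obtain f where f: "bij_betw f (pverts G) (set w)"
    and adj: "\<And>u v. u \<in> pverts G \<Longrightarrow> v \<in> pverts G \<Longrightarrow>
      (u, v) \<in> parcs G \<longleftrightarrow> (f u, f v) \<in> parcs (word_graph L w)"
    using iso unfolding graph_iso_iff[OF wf wf'] by (auto simp: word_graph_def)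
  obtain a b :: "nat \<Rightarrow> nat" where a: "inj_on a (set w)" and b: "inj_on b (set w)"
    and ab: "\<And>u v. u \<in> set w \<Longrightarrow> v \<in> set w \<Longrightarrow> u \<noteq> v \<Longrightarrow>
      proj_word u v w \<in> L \<longleftrightarrow> (a u < a v \<longleftrightarrow> b v < b u)"
    using word_graph_numberings[of w] unfolding assms by blast
  have inj: "inj_on f (pverts G)" and img: "f ` pverts G = set w"
    using f by (simp_all add: bij_betw_def)
  have "permutation_graph G"
  \<comment> \<open>The numberings of the letters are pulled back to \<open>G\<close> along the
    isomorphism \<open>f\<close>.\<close>
  proof (rule permutation_graph_if_numberings[OF G, of "a \<circ> f" "b \<circ> f"])
    show "inj_on (a \<circ> f) (pverts G)" "inj_on (b \<circ> f) (pverts G)"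
      using inj img a b by (simp_all add: comp_inj_on)
    fix u v assume uv: "u \<in> pverts G" "v \<in> pverts G" "u \<noteq> v"
    then have "f u \<in> set w" "f v \<in> set w" "f u \<noteq> f v"
      using inj img by (auto dest: inj_onD)
    then show "(u, v) \<in> parcs G \<longleftrightarrow> ((a \<circ> f) u < (a \<circ> f) v \<longleftrightarrow> (b \<circ> f) v < (b \<circ> f) u)"
      using adj[OF uv(1,2)] ab by (simp add: word_graph_def)
  qed
  then show "G \<in> {G. permutation_graph G}" by simp
next
  fix G :: "'a pair_pre_digraph"
  assume "G \<in> {G. permutation_graph G}"
  then obtain n H where "simple_graph G" "permutation_graph_on n H" "graph_iso G H"
    by (auto simp: permutation_graph_def)
  then show "G \<in> graph_class L"
    unfolding graph_class_def assms by (auto elim: permutation_graph_on_eq_word_graph)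
qed

end
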